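(* Let $L$ be the ring of integer (Lipschitz) quaternions, let $A$ be a $\mathrm{central}^*$ set in $(L,+)$ and let $\langle y_n\rangle_{n=1}^\infty$ be a minimal sequence in $(L,+)$. Then there exists a sum subsystem $\langle x_n\rangle_{n=1}^\infty$ of $\langle y_n\rangle_{n=1}^\infty$ such that whenever $m\geq 2$, $F$ is a finite nonempty subset of $\mathbb{N}$ with $\min F\geq m$, and $b\in AP(\langle x_n\rangle_{n=1}^{m-1})$, one has $b\cdot\sum_{t\in F}x_t\in A$. In particular, $FS(\langle x_n\rangle_{n=1}^\infty)\cup\{b\cdot x_m: m\geq 2 \text{ and } b\in AP(\langle x_n\rangle_{n=1}^{m-1})\}\subseteq A.$
   Context: $L=\{a+bi+cj+dk:a,b,c,d\in\mathbb{Z}\}$ with $i^2=j^2=k^2=ijk=-1$ (a noncommutative ring). For a sequence $\langle x_n\rangle$ and $m\in\mathbb{N}$, $FS(\langle x_n\rangle_{n=m}^\infty)=\{\sum_{n\in F}x_n: F$ a finite nonempty subset of $\{m,m+1,\dots\}\}$. $AP(\langle x_n\rangle_{n=1}^{k})$ is the set of all products $x_{\sigma(1)}x_{\sigma(2)}\cdots x_{\sigma(r)}$ with $r\ge1$ and $\sigma:\{1,\dots,r\}\to\{1,\dots,k\}$ injective (products of terms in any order, no repetitions). A sequence $\langle x_n\rangle$ is a sum subsystem of $\langle y_n\rangle$ if there are finite nonempty $H_n\subseteq\mathbb{N}$ with $\max H_n<\min H_{n+1}$ and $x_n=\sum_{t\in H_n}y_t$. $\beta L$ is the set of ultrafilters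 on $L$ with $A\in p+q$ iff $\{x:-x+A\in q\}\in p$ ($-x+A=\{y:x+y\in A\}$), a compact right topological semigroup with smallest ideal $K(\beta L)$; $\overline{B}=\{p:B\in p\}$. A set is $\mathrm{central}^*$ if it belongs to every idempotent of $K(\beta L)$. A sequence $\langle y_n\rangle$ in $L$ is minimal if $\bigcap_{m=1}^\infty\overline{FS(\langle y_n\rangle_{n=m}^\infty)}\cap K(\beta L)\neq\emptyset$. *)

theory Defs
  imports Complex_Main
begin

section \<open>The ring of integer (Lipschitz) quaternions\<close>

datatype lipschitz = Lipschitz (qRe: int) (qI: int) (qJ: int) (qK: int)

instantiation lipschitz :: ring_1
begin

definition zero_lipschitz :: lipschitz where
  "0 = Lipschitz 0 0 0 0"

definition one_lipschitz :: lipschitz where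
  "1 = Lipschitz 1 0 0 0"

definition uminus_lipschitz :: "lipschitz \<Rightarrow> lipschitz" where
  "- x = Lipschitz (- qRe x) (- qI x) (- qJ x) (- qK x)"

definition plus_lipschitz :: "lipschitz \<Rightarrow> lipschitz \<Rightarrow> lipschitz" where
  "x + y = Lipschitz (qRe x + qRe y) (qI x + qI y) (qJ x + qJ y) (qK x + qK y)"

definition minus_lipschitz :: "lipschitz \<Rightarrow> lipschitz \<Rightarrow> lipschitz" where
  "x - y = Lipschitz (qRe x - qRe y) (qI x - qI y) (qJ x - qJ y) (qK x - qK y)"

definition times_lipschitz :: "lipschitz \<Rightarrow> lipschitz \<Rightarrow> lipschitz" where
  "x * y = Lipschitz
     (qRe x * qRe y - qI x * qI y - qJ x * qJ y - qK x * qK y)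
     (qRe x * qI y + qI x * qRe y + qJ x * qK y - qK x * qJ y)
     (qRe x * qJ y - qI x * qK y + qJ x * qRe y + qK x * qI y)
     (qRe x * qK y + qI x * qJ y - qJ x * qI y + qK x * qRe y)"

instance
  by standard
    (simp_all add: zero_lipschitz_def one_lipschitz_def uminus_lipschitz_def plus_lipschitz_def
      minus_lipschitz_def times_lipschitz_def lipschitz.expand algebra_simps)

end

definition unit_i :: lipschitz where "unit_i = Lipschitz 0 1 0 0"
definition unit_j :: lipschitz where "unit_j = Lipschitz 0 0 1 0"
definition unit_k :: lipschitz where "unit_k = Lipschitz 0 0 0 1"

text \<open>
  By the next two lemmas the coordinate formula for the product is the one forced by
  \<open>i\<^sup>2 = j\<^sup>2 = k\<^sup>2 = ijk = -1\<close>.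
\<close>

lemma lipschitz_unit_relations:
  "unit_i * unit_i = - 1" "unit_j * unit_j = - 1" "unit_k * unit_k = - 1"
  "unit_i * unit_j * unit_k = - 1"
  by (simp_all add: unit_i_def unit_j_def unit_k_def one_lipschitz_def uminus_lipschitz_def
      times_lipschitz_def)

lemma of_int_lipschitz: "of_int a = Lipschitz a 0 0 0"
proof -
  have nat_case: "of_nat n = Lipschitz (int n) 0 0 0" for n
    by (induction n) (simp_all add: zero_lipschitz_def one_lipschitz_def plus_lipschitz_def)
  show ?thesis
    by (cases a) (simp_all add: nat_case one_lipschitz_def plus_lipschitz_def
      uminus_lipschitz_def minus_lipschitz_def)
qed

lemma Lipschitz_eq_basis_expansion:
  "Lipschitz a b c d = of_int a + of_int b * unit_i + of_int c * unit_j + of_int d * unit_k"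
  by (simp add: of_int_lipschitz unit_i_def unit_j_def unit_k_def plus_lipschitz_def
      times_lipschitz_def)

section \<open>The semigroup of ultrafilters\<close>

text \<open>
  An ultrafilter \<open>p\<close> is represented by a value of the library type of filters; the statement
  \<open>B \<in> p\<close> about a set \<open>B\<close> is rendered as \<open>mem_filter B p\<close>.
\<close>

definition mem_filter :: "'a set \<Rightarrow> 'a filter \<Rightarrow> bool" where
  "mem_filter B p \<longleftrightarrow> (\<forall>\<^sub>F x in p. x \<in> B)"

definition beta :: "'a filter set" where
  "beta = {p. p \<noteq> bot \<and> (\<forall>B. mem_filter B p \<or> mem_filter (- B) p)}"

definition beta_closure :: "'a set \<Rightarrow> 'a filter set" where
  "beta_closure B = {p \<in> beta. mem_filter B p}"

definition filter_add :: "'a::plus filter \<Rightarrow> 'a filter \<Rightarrow> 'a filter" (infixl "\<oplus>\<^sub>\<beta>" 65) where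
  "p \<oplus>\<^sub>\<beta> q = Abs_filter (\<lambda>P. \<forall>\<^sub>F x in p. \<forall>\<^sub>F y in q. P (x + y))"

lemma eventually_filter_add:
  "(\<forall>\<^sub>F z in p \<oplus>\<^sub>\<beta> q. P z) \<longleftrightarrow> (\<forall>\<^sub>F x in p. \<forall>\<^sub>F y in q. P (x + y))"
  unfolding filter_add_def
proof (rule eventually_Abs_filter, rule is_filter.intro)
  fix P Q :: "'a \<Rightarrow> bool"
  assume "\<forall>\<^sub>F x in p. \<forall>\<^sub>F y in q. P (x + y)" "\<forall>\<^sub>F x in p. \<forall>\<^sub>F y in q. Q (x + y)"
  then show "\<forall>\<^sub>F x in p. \<forall>\<^sub>F y in q. P (x + y) \<and> Q (x + y)"
    by eventually_elim (rule eventually_conj)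
next
  fix P Q :: "'a \<Rightarrow> bool"
  assume "\<forall>x. P x \<longrightarrow> Q x" "\<forall>\<^sub>F x in p. \<forall>\<^sub>F y in q. P (x + y)"
  then show "\<forall>\<^sub>F x in p. \<forall>\<^sub>F y in q. Q (x + y)"
    by (auto elim!: eventually_mono)
qed simp

lemma mem_filter_add:
  "mem_filter B (p \<oplus>\<^sub>\<beta> q) \<longleftrightarrow> mem_filter {x. mem_filter {y. x + y \<in> B} q} p"
  by (simp add: mem_filter_def eventually_filter_add)

lemma filter_add_in_beta:
  assumes "p \<in> beta" "q \<in> beta"
  shows "p \<oplus>\<^sub>\<beta> q \<in> beta"
proof -
  have ult: "(\<forall>\<^sub>F x in r. \<not> P x) \<longleftrightarrow> \<not> (\<forall>\<^sub>F x in r. P x)" if "r \<in> beta" for r :: "'a filter" and P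
  proof -
    have nb: "r \<noteq> bot" and "mem_filter {x. P x} r \<or> mem_filter (- {x. P x}) r"
      using that unfolding beta_def by blast+
    then have "eventually P r \<or> (\<forall>\<^sub>F x in r. \<not> P x)"
      by (simp add: mem_filter_def)
    moreover have False if "eventually P r" "\<forall>\<^sub>F x in r. \<not> P x"
      using eventually_conj[OF that] nb by simp
    ultimately show ?thesis by blast
  qed
  have nb: "p \<noteq> bot" "q \<noteq> bot"
    using assms by (simp_all add: beta_def)
  then have "\<not> (\<forall>\<^sub>F x in q. False)" "\<not> (\<forall>\<^sub>F x in p. False)"
    by (simp_all add: trivial_limit_def)
  then have "p \<oplus>\<^sub>\<beta> q \<noteq> bot"
    by (simp only: trivial_limit_def eventually_filter_add simp_thms)
  moreover have "mem_filter B (p \<oplus>\<^sub>\<beta> q) \<or> mem_filter (- B) (p \<oplus>\<^sub>\<beta> q)" for B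
    by (simp add: mem_filter_def eventually_filter_add ult assms)
  ultimately show ?thesis
    by (simp add: beta_def)
qed

definition beta_ideal :: "'a::plus filter set \<Rightarrow> bool" where
  "beta_ideal I \<longleftrightarrow> I \<noteq> {} \<and> I \<subseteq> beta \<and>
     (\<forall>p\<in>beta. \<forall>q\<in>I. p \<oplus>\<^sub>\<beta> q \<in> I \<and> q \<oplus>\<^sub>\<beta> p \<in> I)"

text \<open>
  The smallest ideal, defined as the intersection of all two-sided ideals (the smallest ideal,
  whenever there is one, is this intersection).
\<close>

definition K_beta :: "'a::plus filter set" where
  "K_beta = \<Inter> {I. beta_ideal I}"

definition central_star :: "'a::plus set \<Rightarrow> bool" where
  "central_star A \<longleftrightarrow> (\<forall>p\<in>K_beta. p \<oplus>\<^sub>\<beta> p = p \<longrightarrow> mem_filter A p)"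

section \<open>Sequences\<close>

text \<open>
  A sequence indexed by \<open>1, 2, 3, \<dots>\<close> is a function on \<^typ>\<open>nat\<close> whose value at \<open>0\<close> is
  irrelevant: all index sets below are sets of positive naturals.
\<close>

definition FS :: "(nat \<Rightarrow> 'a::comm_monoid_add) \<Rightarrow> nat \<Rightarrow> 'a set" where
  "FS x m = {\<Sum>n\<in>F. x n | F. finite F \<and> F \<noteq> {} \<and> F \<subseteq> {m..}}"

definition AP :: "(nat \<Rightarrow> 'a::monoid_mult) \<Rightarrow> nat \<Rightarrow> 'a set" where
  "AP x k = {prod_list (map (\<lambda>i. x (\<sigma> i)) [1..<r+1]) | r \<sigma>.
     1 \<le> r \<and> inj_on \<sigma> {1..r} \<and> \<sigma> ` {1..r} \<subseteq> {1..k}}"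

definition sum_subsystem ::
  "(nat \<Rightarrow> 'a::comm_monoid_add) \<Rightarrow> (nat \<Rightarrow> 'a) \<Rightarrow> bool" where
  "sum_subsystem x y \<longleftrightarrow> (\<exists>H :: nat \<Rightarrow> nat set. \<forall>n\<ge>1.
     finite (H n) \<and> H n \<noteq> {} \<and> H n \<subseteq> {1..} \<and> Max (H n) < Min (H (n + 1)) \<and>
     x n = (\<Sum>t\<in>H n. y t))"

definition minimal_sequence :: "(nat \<Rightarrow> 'a::comm_monoid_add) \<Rightarrow> bool" where
  "minimal_sequence y \<longleftrightarrow> (\<Inter>m\<in>{1..}. beta_closure (FS y m)) \<inter> K_beta \<noteq> {}"

end

theory Submission
  imports Defs
begin

text \<open>
  If \<open>q \<in> K(\<beta>L)\<close> contains all tails \<open>FS(y,m)\<close>, then the elements of the left ideal \<open>\<beta>L + q\<close> that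
  contain these tails form a compact subsemigroup of \<open>K(\<beta>L)\<close>, so by Ellis' theorem there is an
  idempotent \<open>p \<in> K(\<beta>L)\<close> containing all tails. For \<open>b \<noteq> 0\<close> the subgroup \<open>bL\<close> has finite index,
  since it contains \<open>N(b)L\<close>; hence every ideal of \<open>\<beta>L\<close> has a member concentrated on \<open>bL\<close>, its
  preimage under \<open>u \<mapsto> b u\<close> is again an ideal, and \<open>b p\<close> is an idempotent of \<open>K(\<beta>L)\<close>.
  Therefore \<open>{z. b z \<in> A}\<close> belongs to \<open>p\<close> for every \<open>b \<noteq> 0\<close>, and the sequence \<open>x\<close> is
  constructed as in the proof of Hindman's theorem.
\<close>

section \<open>Ultrafilters\<close>

lemma eventually_disj_beta:
  assumes "p \<in> beta"
  shows "(\<forall>\<^sub>F x in p. P x \<or> Q x) \<longleftrightarrow> eventually P p \<or> eventually Q p"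
proof
  assume *: "\<forall>\<^sub>F x in p. P x \<or> Q x"
  have "eventually P p \<or> (\<forall>\<^sub>F x in p. \<not> P x)"
    using assms unfolding beta_def mem_filter_def
    by (auto dest!: spec[of _ "{x. P x}"])
  moreover have "eventually Q p" if "\<forall>\<^sub>F x in p. \<not> P x"
    using * that by eventually_elim auto
  ultimately show "eventually P p \<or> eventually Q p" by blast
qed (auto elim: eventually_mono)

lemma eventually_not_beta:
  assumes "p \<in> beta"
  shows "(\<forall>\<^sub>F x in p. \<not> P x) \<longleftrightarrow> \<not> eventually P p"
proof -
  have "p \<noteq> bot" using assms by (simp add: beta_def)
  then have "\<not> ((\<forall>\<^sub>F x in p. \<not> P x) \<and> eventually P p)"
    using eventually_conj[of "\<lambda>x. \<not> P x" p P] by auto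
  moreover have "(\<forall>\<^sub>F x in p. \<not> P x) \<or> eventually P p"
    using eventually_disj_beta[OF assms, of "\<lambda>x. \<not> P x" P] by simp
  ultimately show ?thesis by blast
qed

lemma betaI:
  assumes "p \<noteq> bot" "\<And>P. eventually P p \<or> (\<forall>\<^sub>F x in p. \<not> P x)"
  shows "p \<in> beta"
  using assms by (simp add: beta_def mem_filter_def)

lemma beta_le_neq_bot: "p \<in> beta \<Longrightarrow> p \<le> F \<Longrightarrow> F \<noteq> bot"
  by (auto simp: beta_def bot.extremum_unique)

lemma le_beta_eq:
  assumes "p \<in> beta" "q \<in> beta" "p \<le> q"
  shows "p = q"
proof (rule antisym[OF assms(3)], rule filter_leI)
  fix P assume "eventually P p"
  show "eventually P q"
  proof (rule ccontr)
    assume "\<not> eventually P q"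
    then have "\<forall>\<^sub>F x in q. \<not> P x" using eventually_not_beta[OF assms(2)] by blast
    then have "\<forall>\<^sub>F x in p. \<not> P x" using assms(3) by (rule filter_leD[rotated])
    then show False using \<open>eventually P p\<close> eventually_not_beta[OF assms(1)] by blast
  qed
qed

text \<open>Compactness for chains: a chain is a filter base of its infimum, so if the infimum were
  \<open>bot\<close>, a single member would already be \<open>bot\<close>.\<close>

lemma Inf_chain_neq_bot:
  fixes C :: "'a filter set"
  assumes "C \<noteq> {}" "\<And>F G. F \<in> C \<Longrightarrow> G \<in> C \<Longrightarrow> F \<le> G \<or> G \<le> F" "bot \<notin> C"
  shows "Inf C \<noteq> bot"
proof
  assume "Inf C = bot"
  then have "eventually (\<lambda>_. False) (Inf C)" by simp
  moreover have "\<exists>x\<in>C. x \<le> inf F G" if "F \<in> C" "G \<in> C" for F G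
    using assms(2)[OF that] that by (auto intro: inf.boundedI)
  ultimately have "\<exists>F\<in>C. eventually (\<lambda>_. False) F"
    using eventually_Inf_base[OF assms(1)] by blast
  then show False using assms(3) by (auto simp: eventually_False)
qed

text \<open>Zorn's lemma for the reversed order, with \<open>Inf C\<close> as the bound of a
  nonempty chain. A trivial \<open>S\<close> yields ultrafilters, and
  \<open>semigroup_filter\<close> yields minimal compact subsemigroups.\<close>

lemma minimal_filter_exists:
  fixes F :: "'a filter"
  assumes "F \<noteq> bot" "S F"
    and "\<And>C. C \<noteq> {} \<Longrightarrow> (\<And>G. G \<in> C \<Longrightarrow> S G) \<Longrightarrow> S (Inf C)"
  shows "\<exists>G\<le>F. G \<noteq> bot \<and> S G \<and> (\<forall>H\<le>G. H \<noteq> bot \<longrightarrow> S H \<longrightarrow> H = G)"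
proof -
  let ?A = "{G. G \<le> F \<and> G \<noteq> bot \<and> S G}"
  have "\<exists>m\<in>?A. \<forall>a\<in>?A. a \<le> m \<longrightarrow> a = m"
  proof (rule predicate_Zorn[of ?A "\<lambda>G H. H \<le> G"])
    show "partial_order_on ?A (relation_of (\<lambda>G H. H \<le> G) ?A)"
      by (rule partial_order_on_relation_ofI) auto
  next
    fix C :: "'a filter set" assume C: "C \<in> Chains (relation_of (\<lambda>G H. H \<le> G) ?A)"
    then have sub: "C \<subseteq> ?A" and ch: "\<And>G H. G \<in> C \<Longrightarrow> H \<in> C \<Longrightarrow> G \<le> H \<or> H \<le> G"
      by (auto simp: Chains_def relation_of_def)
    show "\<exists>u\<in>?A. \<forall>a\<in>C. u \<le> a"
    proof (cases "C = {}")
      case True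
      then show ?thesis using assms(1,2) by auto
    next
      case False
      then have "Inf C \<in> ?A"
        using sub ch assms(3)[of C] Inf_chain_neq_bot[of C]
        by (auto intro: Inf_lower2)
      then show ?thesis using Inf_lower by blast
    qed
  qed
  then obtain m where "m \<in> ?A" and m: "\<And>a. a \<in> ?A \<Longrightarrow> a \<le> m \<Longrightarrow> a = m" by blast
  moreover have "H = m" if "H \<le> m" "H \<noteq> bot" "S H" for H
    using \<open>m \<in> ?A\<close> m[of H] that by (auto intro: order_trans)
  ultimately show ?thesis by blast
qed

lemma ultrafilter_below:
  assumes "F \<noteq> bot"
  shows "\<exists>p\<in>beta. p \<le> F"
proof -
  obtain p where p: "p \<le> F" "p \<noteq> bot" and min: "\<And>H. H \<le> p \<Longrightarrow> H \<noteq> bot \<Longrightarrow> H = p"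
    using minimal_filter_exists[of F "\<lambda>_. True", OF assms] by blast
  have "p \<in> beta"
  proof (rule betaI[OF p(2)])
    \<comment> \<open>By minimality, adjoining \<open>{x. P x}\<close> to \<open>p\<close> gives
      \<open>bot\<close> or \<open>p\<close> itself, and this decides \<open>P\<close>.\<close>
    fix P
    have "\<forall>\<^sub>F x in p. \<not> P x" if "inf p (principal {x. P x}) = bot"
    proof -
      have "eventually (\<lambda>_. False) (inf p (principal {x. P x}))"
        by (simp only: that eventually_bot)
      then show ?thesis by (simp add: eventually_inf_principal)
    qed
    moreover have "eventually P p" if "inf p (principal {x. P x}) = p"
    proof -
      have "eventually P (inf p (principal {x. P x}))" by (simp add: eventually_inf_principal)
      then show ?thesis by (simp only: that)
    qed
    ultimately show "eventually P p \<or> (\<forall>\<^sub>F x in p. \<not> P x)"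
      using min[of "inf p (principal {x. P x})"] by auto
  qed
  with p(1) show ?thesis by blast
qed

text \<open>If \<open>P\<close> holds eventually in \<open>G\<close> but not in \<open>F\<close>,
  the complement of \<open>P\<close> can be adjoined to \<open>F\<close>, and an ultrafilter below
  the result violates the assumption. Thus inclusion of the encoded closed sets implies the order of
  the filters.\<close>

lemma le_filter_if_ultrafilters_le:
  assumes "\<And>u. u \<in> beta \<Longrightarrow> u \<le> F \<Longrightarrow> u \<le> G"
  shows "F \<le> G"
proof (rule filter_leI, rule ccontr)
  fix P assume G: "eventually P G" and F: "\<not> eventually P F"
  have "inf F (principal {x. \<not> P x}) \<noteq> bot"
    using F by (simp add: trivial_limit_def eventually_inf_principal)
  then obtain u where u: "u \<in> beta" "u \<le> inf F (principal {x. \<not> P x})"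
    using ultrafilter_below by blast
  then have "eventually P u"
    using assms G by (meson filter_leD le_inf_iff)
  moreover have "\<forall>\<^sub>F x in u. \<not> P x"
    using u(2) by (rule filter_leD) (simp add: eventually_inf_principal)
  ultimately show False using eventually_not_beta[OF u(1)] by blast
qed

lemma eventually_finite_partition:
  assumes "p \<in> beta" "finite I" "\<forall>\<^sub>F x in p. \<exists>i\<in>I. P i x"
  shows "\<exists>i\<in>I. eventually (P i) p"
proof (rule ccontr)
  assume "\<not> ?thesis"
  then have "\<forall>i\<in>I. \<forall>\<^sub>F x in p. \<not> P i x" using eventually_not_beta[OF assms(1)] by blast
  then have "\<forall>\<^sub>F x in p. \<forall>i\<in>I. \<not> P i x" by (simp add: eventually_ball_finite assms(2))
  then have "\<forall>\<^sub>F x in p. \<not> (\<exists>i\<in>I. P i x)" by eventually_elim auto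
  then show False using assms(3) eventually_not_beta[OF assms(1)] by blast
qed

lemma filtermap_beta:
  assumes "p \<in> beta"
  shows "filtermap f p \<in> beta"
proof (rule betaI)
  show "filtermap f p \<noteq> bot" using assms by (simp add: filtermap_bot_iff beta_def)
  show "eventually P (filtermap f p) \<or> (\<forall>\<^sub>F x in filtermap f p. \<not> P x)" for P
    by (simp add: eventually_filtermap eventually_not_beta[OF assms])
qed

lemma principal_singleton_beta: "principal {a} \<in> beta"
  by (rule betaI) (simp_all add: eventually_principal principal_eq_bot_iff)

section \<open>Idempotents in compact subsemigroups\<close>

lemma filter_add_assoc:
  fixes p q r :: "'a::semigroup_add filter"
  shows "p \<oplus>\<^sub>\<beta> q \<oplus>\<^sub>\<beta> r = p \<oplus>\<^sub>\<beta> (q \<oplus>\<^sub>\<beta> r)"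
  by (simp add: filter_eq_iff eventually_filter_add add.assoc)

lemma filter_add_mono_left: "F \<le> G \<Longrightarrow> F \<oplus>\<^sub>\<beta> p \<le> G \<oplus>\<^sub>\<beta> p"
  by (simp add: le_filter_def eventually_filter_add)

text \<open>Encodes a fibre of right translation by \<open>p\<close>, namely the closed set of those
  ultrafilters \<open>u \<le> F\<close> that are sent to \<open>r\<close>. Each \<open>B\<close> in
  \<open>r\<close> contributes the condition that \<open>B\<close> belongs to the translate of
  \<open>u\<close>.\<close>

definition add_fiber :: "'a::plus filter \<Rightarrow> 'a filter \<Rightarrow> 'a filter \<Rightarrow> 'a filter" where
  "add_fiber F p r =
     inf F (INF B\<in>{B. mem_filter B r}. principal {x. \<forall>\<^sub>F y in p. x + y \<in> B})"

lemma le_add_fiber_iff: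
  assumes "u \<in> beta" "p \<in> beta" "r \<in> beta"
  shows "u \<le> add_fiber F p r \<longleftrightarrow> u \<le> F \<and> u \<oplus>\<^sub>\<beta> p = r"
proof -
  have "(\<forall>B\<in>{B. mem_filter B r}. u \<le> principal {x. \<forall>\<^sub>F y in p. x + y \<in> B})
      \<longleftrightarrow> (\<forall>B. mem_filter B r \<longrightarrow> mem_filter B (u \<oplus>\<^sub>\<beta> p))"
    by (simp add: mem_filter_def le_principal eventually_filter_add)
  also have "\<dots> \<longleftrightarrow> u \<oplus>\<^sub>\<beta> p \<le> r"
    unfolding le_filter_def mem_filter_def
    by (metis (mono_tags) eventually_mono mem_Collect_eq)
  also have "\<dots> \<longleftrightarrow> u \<oplus>\<^sub>\<beta> p = r"
    using le_beta_eq filter_add_in_beta assms by blast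
  finally show ?thesis by (simp add: add_fiber_def le_INF_iff)
qed

text \<open>
  A filter \<open>F\<close> encodes the closed set of ultrafilters \<open>u \<le> F\<close>; the lemma says that right
  translation by \<open>p\<close> maps this set onto the closed set encoded by \<open>F \<oplus>\<^sub>\<beta> p\<close>.
\<close>

lemma le_filter_add_obtains:
  assumes p: "p \<in> beta" and r: "r \<in> beta" and le: "r \<le> F \<oplus>\<^sub>\<beta> p"
  obtains u where "u \<in> beta" "u \<le> F" "u \<oplus>\<^sub>\<beta> p = r"
proof -
  let ?D = "\<lambda>B. {x. \<forall>\<^sub>F y in p. x + y \<in> B}"
  have "add_fiber F p r \<noteq> bot"
  proof
    assume "add_fiber F p r = bot"
    then have "eventually (\<lambda>_. False) (add_fiber F p r)" by simp
    then obtain P Q where P: "eventually P F"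
      and Q: "eventually Q (INF B\<in>{B. mem_filter B r}. principal (?D B))"
      and PQ: "\<And>x. \<not> (P x \<and> Q x)"
      unfolding add_fiber_def eventually_inf by auto
    \<comment> \<open>The sets \<open>?D B\<close> are directed, since
      \<open>?D (B \<inter> C)\<close> lies in both \<open>?D B\<close> and \<open>?D C\<close>;
      hence one \<open>B\<close> suffices for the contradiction.\<close>
    have "\<exists>B\<in>{B. mem_filter B r}. eventually Q (principal (?D B))"
    proof (rule eventually_INF_base[THEN iffD1, OF _ _ Q])
      show "{B. mem_filter B r} \<noteq> {}" by (auto simp: mem_filter_def intro: exI[of _ UNIV])
      fix B C assume "B \<in> {B. mem_filter B r}" "C \<in> {B. mem_filter B r}"
      then show "\<exists>X\<in>{B. mem_filter B r}. principal (?D X) \<le> inf (principal (?D B)) (principal (?D C))"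
        by (intro bexI[of _ "B \<inter> C"]) (auto simp: mem_filter_def eventually_conj_iff)
    qed
    then obtain B where B: "mem_filter B r" and QB: "\<And>x. x \<in> ?D B \<Longrightarrow> Q x"
      by (auto simp: eventually_principal)
    from P have "\<forall>\<^sub>F x in F. \<forall>\<^sub>F y in p. x + y \<notin> B"
    proof eventually_elim
      case (elim x)
      then have "x \<notin> ?D B" using PQ QB by blast
      then show ?case using eventually_not_beta[OF p] by simp
    qed
    then have "\<forall>\<^sub>F z in F \<oplus>\<^sub>\<beta> p. z \<notin> B" by (simp add: eventually_filter_add)
    then have "\<forall>\<^sub>F z in r. z \<notin> B" using le by (rule filter_leD[rotated])
    then show False using B eventually_not_beta[OF r] by (simp add: mem_filter_def)
  qed
  then obtain u where "u \<in> beta" "u \<le> add_fiber F p r" using ultrafilter_below by blast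
  then show thesis using that le_add_fiber_iff[OF _ p r] by blast
qed

text \<open>The closed set encoded by \<open>F\<close> is a subsemigroup; the condition concerns
  only the ultrafilters below \<open>F\<close>.\<close>

definition semigroup_filter :: "'a::plus filter \<Rightarrow> bool" where
  "semigroup_filter F \<longleftrightarrow> (\<forall>p\<in>beta. \<forall>q\<in>beta. p \<le> F \<longrightarrow> q \<le> F \<longrightarrow> p \<oplus>\<^sub>\<beta> q \<le> F)"

text \<open>Ellis' argument: let \<open>G\<close> encode a minimal compact subsemigroup containing
  \<open>p\<close>. Its right translate by \<open>p\<close> is again a compact subsemigroup, hence
  all of \<open>G\<close>, so some \<open>u\<close> in it fixes \<open>p\<close> from the left. All
  such \<open>u\<close> form a compact subsemigroup too, which is again \<open>G\<close> and
  therefore contains \<open>p\<close>.\<close>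

theorem idempotent_exists:
  fixes F :: "'a::semigroup_add filter"
  assumes "F \<noteq> bot" "semigroup_filter F"
  shows "\<exists>p\<in>beta. p \<le> F \<and> p \<oplus>\<^sub>\<beta> p = p"
proof -
  have "semigroup_filter (Inf C)" if "\<And>G. G \<in> C \<Longrightarrow> semigroup_filter G" for C :: "'a filter set"
    using that unfolding semigroup_filter_def by (simp add: le_Inf_iff)
  then obtain G where G: "G \<le> F" "G \<noteq> bot" "semigroup_filter G"
    and min: "\<And>H. H \<le> G \<Longrightarrow> H \<noteq> bot \<Longrightarrow> semigroup_filter H \<Longrightarrow> H = G"
    using minimal_filter_exists[of F semigroup_filter, OF assms] by blast
  have add: "p \<oplus>\<^sub>\<beta> q \<le> G" if "p \<in> beta" "q \<in> beta" "p \<le> G" "q \<le> G" for p q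
    using that G(3) by (simp add: semigroup_filter_def)
  obtain p where p: "p \<in> beta" "p \<le> G" using ultrafilter_below[OF G(2)] by blast
  have "G \<oplus>\<^sub>\<beta> p = G"
  proof (rule min)
    show "G \<oplus>\<^sub>\<beta> p \<le> G"
      by (rule le_filter_if_ultrafilters_le) (metis le_filter_add_obtains add p)
    show "G \<oplus>\<^sub>\<beta> p \<noteq> bot"
      by (rule beta_le_neq_bot[OF filter_add_in_beta[OF p(1) p(1)] filter_add_mono_left[OF p(2)]])
    show "semigroup_filter (G \<oplus>\<^sub>\<beta> p)"
      unfolding semigroup_filter_def
    proof (intro ballI impI)
      fix r s assume r: "r \<in> beta" "r \<le> G \<oplus>\<^sub>\<beta> p" and s: "s \<in> beta" "s \<le> G \<oplus>\<^sub>\<beta> p"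
      obtain u where u: "u \<in> beta" "u \<le> G" "u \<oplus>\<^sub>\<beta> p = r"
        using le_filter_add_obtains[OF p(1) r] .
      obtain v where v: "v \<in> beta" "v \<le> G" "v \<oplus>\<^sub>\<beta> p = s"
        using le_filter_add_obtains[OF p(1) s] .
      have "r \<oplus>\<^sub>\<beta> s = u \<oplus>\<^sub>\<beta> p \<oplus>\<^sub>\<beta> v \<oplus>\<^sub>\<beta> p" using u v by (simp add: filter_add_assoc)
      moreover have "u \<oplus>\<^sub>\<beta> p \<oplus>\<^sub>\<beta> v \<le> G"
        by (intro add filter_add_in_beta u v p)
      ultimately show "r \<oplus>\<^sub>\<beta> s \<le> G \<oplus>\<^sub>\<beta> p" by (simp add: filter_add_mono_left)
    qed
  qed
  then obtain u where u: "u \<in> beta" "u \<le> G" "u \<oplus>\<^sub>\<beta> p = p"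
    using le_filter_add_obtains[OF p(1) p(1), of G] p(2) by auto
  have "add_fiber G p p = G"
  proof (rule min)
    show "add_fiber G p p \<le> G" by (simp add: add_fiber_def)
    show "add_fiber G p p \<noteq> bot"
      using u le_add_fiber_iff[OF u(1) p(1) p(1), of G] beta_le_neq_bot by blast
    show "semigroup_filter (add_fiber G p p)"
      unfolding semigroup_filter_def
      by (simp add: le_add_fiber_iff p filter_add_in_beta add filter_add_assoc)
  qed
  then have "p \<oplus>\<^sub>\<beta> p = p" using le_add_fiber_iff[OF p(1) p(1) p(1), of G] p(2) by simp
  then show ?thesis using p G(1) by (meson order_trans)
qed

section \<open>The smallest ideal\<close>

text \<open>Ensures that the intersection defining \<open>K_beta\<close> is not taken over an empty
  family.\<close>

lemma beta_ideal_beta: "beta_ideal (beta :: 'a::plus filter set)"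
  using principal_singleton_beta by (fastforce simp: beta_ideal_def filter_add_in_beta)

lemma K_beta_subset_beta: "K_beta \<subseteq> beta"
  using beta_ideal_beta by (auto simp: K_beta_def)

lemma filter_add_K_beta: "p \<in> beta \<Longrightarrow> q \<in> K_beta \<Longrightarrow> p \<oplus>\<^sub>\<beta> q \<in> K_beta"
  by (auto simp: K_beta_def beta_ideal_def)

text \<open>In an infinite group the nonprincipal ultrafilters form an ideal, by cancellation, and
  this ideal contains \<open>K_beta\<close>.\<close>

lemma K_beta_nonprincipal:
  fixes p :: "'a::group_add filter"
  assumes "infinite (UNIV :: 'a set)" "p \<in> K_beta"
  shows "\<forall>\<^sub>F x in p. x \<noteq> z"
proof -
  let ?I = "{p \<in> beta. \<forall>z :: 'a. \<forall>\<^sub>F x in p. x \<noteq> z}"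
  have "(cofinite :: 'a filter) \<noteq> bot" using assms(1) by (simp add: cofinite_bot)
  then obtain c :: "'a filter" where c: "c \<in> beta" "c \<le> cofinite"
    using ultrafilter_below by blast
  have "\<forall>\<^sub>F x in c. x \<noteq> z" for z
    using c(2) by (rule filter_leD) (simp add: eventually_cofinite)
  then have "c \<in> ?I" using c(1) by simp
  moreover have "p \<oplus>\<^sub>\<beta> q \<in> ?I" if p: "p \<in> beta" and q: "q \<in> ?I" for p q
  proof -
    have "\<forall>\<^sub>F y in q. x + y \<noteq> z" for x z
    proof -
      have "\<forall>\<^sub>F y in q. y \<noteq> - x + z" using q by blast
      then show ?thesis by eventually_elim (auto simp: add.assoc[symmetric])
    qed
    then show ?thesis using p q by (simp add: filter_add_in_beta eventually_filter_add)
  qed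
  moreover have "q \<oplus>\<^sub>\<beta> p \<in> ?I" if p: "p \<in> beta" and q: "q \<in> ?I" for p q
  proof -
    have "\<forall>\<^sub>F x in q. \<forall>\<^sub>F y in p. x + y \<noteq> z" for z
    \<comment> \<open>If \<open>p\<close> is principal at \<open>a\<close>, then \<open>q\<close>
      must avoid \<open>z - a\<close>; otherwise \<open>p\<close> avoids \<open>- x + z\<close> for
      every \<open>x\<close>.\<close>
    proof (cases "\<exists>a. \<forall>\<^sub>F y in p. y = a")
      case True
      then obtain a where a: "\<forall>\<^sub>F y in p. y = a" by blast
      have "\<forall>\<^sub>F x in q. x \<noteq> z - a" using q by blast
      then show ?thesis
      proof eventually_elim
        case (elim x)
        from a show ?case by eventually_elim (use elim in \<open>auto simp: eq_diff_eq\<close>)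
      qed
    next
      case False
      have "\<forall>\<^sub>F y in p. x + y \<noteq> z" for x
      proof -
        have "\<forall>\<^sub>F y in p. y \<noteq> - x + z" using False eventually_not_beta[OF p] by blast
        then show ?thesis by eventually_elim (auto simp: add.assoc[symmetric])
      qed
      then show ?thesis by simp
    qed
    then show ?thesis using p q by (simp add: filter_add_in_beta eventually_filter_add)
  qed
  ultimately have "beta_ideal ?I" unfolding beta_ideal_def by blast
  then show ?thesis using assms(2) by (auto simp: K_beta_def)
qed

text \<open>The hypothesis on \<open>R\<close> says that the image of \<open>h\<close> has finite index.\<close>

lemma filtermap_K_beta:
  fixes h :: "'a::group_add \<Rightarrow> 'a"
  assumes hom: "\<And>x y. h (x + y) = h x + h y"
    and fin: "finite R" "\<And>x. \<exists>c\<in>R. c + x \<in> range h"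
    and p: "p \<in> K_beta"
  shows "filtermap h p \<in> K_beta"
  unfolding K_beta_def
proof (rule InterI, clarify)
  fix I :: "'a filter set" assume I: "beta_ideal I"
  \<comment> \<open>The preimage of \<open>I\<close> is closed under addition from both sides
    because \<open>h\<close> is additive; the real task is to show that it is nonempty.\<close>
  let ?J = "{u \<in> beta. filtermap h u \<in> I}"
  have map_add: "filtermap h (u \<oplus>\<^sub>\<beta> v) = filtermap h u \<oplus>\<^sub>\<beta> filtermap h v" for u v
    by (simp add: filter_eq_iff eventually_filter_add eventually_filtermap hom)
  obtain r where r: "r \<in> I" "r \<in> beta" using I by (auto simp: beta_ideal_def)
  \<comment> \<open>Finitely many translates cover everything, so the ultrafilter \<open>r\<close>
    selects one \<open>c\<close>. Adding \<open>principal {c}\<close> on the left stays in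
    \<open>I\<close> and moves \<open>r\<close> onto \<open>range h\<close>.\<close>
  obtain c where "\<forall>\<^sub>F x in r. c + x \<in> range h"
    using eventually_finite_partition[OF r(2) fin(1), of "\<lambda>c x. c + x \<in> range h"] fin(2) by auto
  then have s: "\<forall>\<^sub>F x in principal {c} \<oplus>\<^sub>\<beta> r. x \<in> range h" (is "eventually _ ?s")
    by (simp add: eventually_filter_add eventually_principal)
  have sI: "?s \<in> I" "?s \<in> beta"
    using I r principal_singleton_beta[of c] by (auto simp: beta_ideal_def)
  \<comment> \<open>As \<open>?s\<close> is concentrated on \<open>range h\<close>, it can be pulled
    back; any ultrafilter below the pullback is mapped exactly to \<open>?s\<close>.\<close>
  have "filtercomap h ?s \<noteq> bot"
  proof
    assume "filtercomap h ?s = bot"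
    then have "eventually (\<lambda>_. False) (filtercomap h ?s)" by simp
    then obtain Q where Q: "eventually Q ?s" "\<And>x. \<not> Q (h x)"
      by (auto simp: eventually_filtercomap)
    from s have "\<forall>\<^sub>F x in ?s. \<not> Q x" by eventually_elim (use Q(2) in auto)
    then show False using Q(1) eventually_not_beta[OF sI(2)] by blast
  qed
  then obtain u where u: "u \<in> beta" "u \<le> filtercomap h ?s" using ultrafilter_below by blast
  then have "filtermap h u \<le> ?s" by (simp add: filtermap_le_iff_le_filtercomap)
  then have "filtermap h u = ?s" using le_beta_eq filtermap_beta u(1) sI(2) by blast
  then have "u \<in> ?J" using u(1) sI(1) by simp
  then have "beta_ideal ?J"
    using I unfolding beta_ideal_def by (auto simp: map_add filter_add_in_beta filtermap_beta)
  then show "filtermap h p \<in> I" using p by (auto simp: K_beta_def)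
qed

section \<open>Lipschitz quaternions\<close>

definition lipschitz_cnj :: "lipschitz \<Rightarrow> lipschitz" where
  "lipschitz_cnj b = Lipschitz (qRe b) (- qI b) (- qJ b) (- qK b)"

definition lipschitz_norm :: "lipschitz \<Rightarrow> int" where
  "lipschitz_norm b = qRe b * qRe b + qI b * qI b + qJ b * qJ b + qK b * qK b"

lemma lipschitz_norm_eq_0_iff: "lipschitz_norm b = 0 \<longleftrightarrow> b = 0"
proof -
  have "lipschitz_norm b = 0 \<longleftrightarrow> qRe b = 0 \<and> qI b = 0 \<and> qJ b = 0 \<and> qK b = 0"
    unfolding lipschitz_norm_def
    by (smt (verit, best) mult_eq_0_iff zero_le_square mult_zero_left)
  then show ?thesis by (cases b) (simp add: zero_lipschitz_def)
qed

lemma mult_lipschitz_cnj: "b * lipschitz_cnj b = of_int (lipschitz_norm b)"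
  by (simp add: of_int_lipschitz times_lipschitz_def lipschitz_cnj_def lipschitz_norm_def
      algebra_simps)

lemma lipschitz_cnj_mult: "lipschitz_cnj b * b = of_int (lipschitz_norm b)"
  by (simp add: of_int_lipschitz times_lipschitz_def lipschitz_cnj_def lipschitz_norm_def
      algebra_simps)

lemma of_int_mult_lipschitz:
  "of_int a * x = Lipschitz (a * qRe x) (a * qI x) (a * qJ x) (a * qK x)"
  by (simp add: of_int_lipschitz times_lipschitz_def)

text \<open>Left multiplication by the conjugate of \<open>b\<close> turns \<open>b * z\<close> into
  an integer multiple of \<open>z\<close>.\<close>

lemma lipschitz_mult_eq_0:
  fixes b z :: lipschitz
  assumes "b * z = 0"
  shows "b = 0 \<or> z = 0"
proof -
  have "of_int (lipschitz_norm b) * z = 0"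
    by (simp add: lipschitz_cnj_mult[symmetric] mult.assoc assms)
  then have "lipschitz_norm b = 0 \<or> z = 0"
    by (cases z) (auto simp: of_int_mult_lipschitz zero_lipschitz_def)
  then show ?thesis by (simp add: lipschitz_norm_eq_0_iff)
qed

lemma finite_index_mult:
  fixes b :: lipschitz
  assumes "b \<noteq> 0"
  shows "\<exists>R. finite R \<and> (\<forall>x. \<exists>c\<in>R. c + x \<in> range ((*) b))"
proof -
  define N where "N = lipschitz_norm b"
  have N: "N > 0"
    using lipschitz_norm_eq_0_iff[of b] assms
    by (simp add: N_def less_le) (simp add: lipschitz_norm_def)
  let ?T = "{0..N}"
  \<comment> \<open>Negated residues modulo \<open>N\<close>: adding the right one to
    \<open>x\<close> leaves a multiple of \<open>N\<close>, hence of \<open>b\<close> from the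
    left.\<close>
  let ?R = "(\<lambda>(s, t, u, v). Lipschitz (-s) (-t) (-u) (-v)) ` (?T \<times> ?T \<times> ?T \<times> ?T)"
  have "\<exists>c\<in>?R. c + x \<in> range ((*) b)" for x
  proof
    let ?c = "Lipschitz (- (qRe x mod N)) (- (qI x mod N)) (- (qJ x mod N)) (- (qK x mod N))"
    let ?z = "Lipschitz (qRe x div N) (qI x div N) (qJ x div N) (qK x div N)"
    show "?c \<in> ?R"
      using N by (intro image_eqI[of _ _ "(qRe x mod N, qI x mod N, qJ x mod N, qK x mod N)"])
        (auto simp: less_imp_le)
    have "?c + x = of_int N * ?z"
      by (simp add: of_int_mult_lipschitz plus_lipschitz_def minus_mod_eq_mult_div)
    also have "\<dots> = b * (lipschitz_cnj b * ?z)"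
      by (simp add: N_def mult_lipschitz_cnj[symmetric] mult.assoc)
    finally show "?c + x \<in> range ((*) b)" by simp
  qed
  then show ?thesis by (intro exI[of _ ?R]) auto
qed

lemma mult_K_beta:
  fixes b :: lipschitz
  assumes "b \<noteq> 0" "p \<in> K_beta"
  shows "filtermap ((*) b) p \<in> K_beta"
  using finite_index_mult[OF assms(1)] filtermap_K_beta[of "(*) b" _ p] assms(2)
  by (auto simp: distrib_left)

lemma infinite_UNIV_lipschitz: "infinite (UNIV :: lipschitz set)"
proof -
  have "inj (\<lambda>n. Lipschitz n 0 0 0)" by (simp add: inj_def)
  then show ?thesis by (metis finite_imageD finite_subset infinite_UNIV_int subset_UNIV)
qed

lemma central_star_mult:
  fixes b :: lipschitz
  assumes A: "central_star A" and p: "p \<in> K_beta" "p \<oplus>\<^sub>\<beta> p = p" and b: "b \<noteq> 0"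
  shows "\<forall>\<^sub>F z in p. b * z \<in> A"
proof -
  let ?q = "filtermap ((*) b) p"
  have "?q \<oplus>\<^sub>\<beta> ?q = filtermap ((*) b) (p \<oplus>\<^sub>\<beta> p)"
    by (simp add: filter_eq_iff eventually_filter_add eventually_filtermap distrib_left)
  then have "mem_filter A ?q" using A mult_K_beta[OF b p(1)] p(2) by (simp add: central_star_def)
  then show ?thesis by (simp add: mem_filter_def eventually_filtermap)
qed

section \<open>Minimal sequences\<close>

text \<open>Any \<open>k\<close> beyond the indices used in \<open>a\<close> makes the index sets
  disjoint. This is why the ultrafilters containing all tails form a semigroup.\<close>

lemma FS_add:
  fixes y :: "nat \<Rightarrow> 'a::comm_monoid_add"
  assumes "a \<in> FS y m"
  shows "\<exists>k\<ge>1. \<forall>c\<in>FS y k. a + c \<in> FS y m"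
proof -
  obtain F where F: "finite F" "F \<noteq> {}" "F \<subseteq> {m..}" "a = sum y F"
    using assms by (auto simp: FS_def)
  show ?thesis
  proof (intro exI[of _ "Suc (Max F)"] conjI ballI)
    fix c assume "c \<in> FS y (Suc (Max F))"
    then obtain G where G: "finite G" "G \<noteq> {}" "G \<subseteq> {Suc (Max F)..}" "c = sum y G"
      by (auto simp: FS_def)
    have lt: "f < g" if "f \<in> F" "g \<in> G" for f g
      using Max_ge[OF F(1) that(1)] G(3) that(2) by fastforce
    then have "F \<inter> G = {}" by blast
    then have "a + c = sum y (F \<union> G)" using F G by (simp add: sum.union_disjoint)
    moreover have "F \<union> G \<subseteq> {m..}"
      using F(2,3) lt by (force simp: subset_iff)
    ultimately show "a + c \<in> FS y m" using F(1,2) G(1) unfolding FS_def by blast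
  qed simp
qed

lemma minimal_sequence_idempotent:
  fixes y :: "nat \<Rightarrow> 'a::comm_monoid_add"
  assumes "minimal_sequence y"
  obtains p where "p \<in> K_beta" "p \<oplus>\<^sub>\<beta> p = p" "\<And>m. 1 \<le> m \<Longrightarrow> mem_filter (FS y m) p"
proof -
  obtain q where q: "q \<in> K_beta" "\<And>m. 1 \<le> m \<Longrightarrow> mem_filter (FS y m) q"
    using assms by (auto simp: minimal_sequence_def beta_closure_def)
  have qb: "q \<in> beta" using q(1) K_beta_subset_beta by blast
  define T where "T = (INF m\<in>{1..}. principal (FS y m))"
  have T: "r \<le> T \<longleftrightarrow> (\<forall>m\<ge>1. mem_filter (FS y m) r)" for r
    by (simp add: T_def le_INF_iff le_principal mem_filter_def) auto
  have T_add: "r \<oplus>\<^sub>\<beta> s \<le> T" if "r \<le> T" "s \<le> T" for r s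
    unfolding T
  proof (intro allI impI)
    fix m :: nat assume "1 \<le> m"
    then have "\<forall>\<^sub>F x in r. x \<in> FS y m" using that T by (simp add: mem_filter_def)
    then have "\<forall>\<^sub>F x in r. \<forall>\<^sub>F z in s. x + z \<in> FS y m"
    proof eventually_elim
      case (elim x)
      then obtain k where k: "k \<ge> 1" "\<forall>c\<in>FS y k. x + c \<in> FS y m" using FS_add by blast
      have "\<forall>\<^sub>F z in s. z \<in> FS y k" using that(2) k(1) T by (simp add: mem_filter_def)
      then show ?case by eventually_elim (use k(2) in blast)
    qed
    then show "mem_filter (FS y m) (r \<oplus>\<^sub>\<beta> s)" by (simp add: mem_filter_def eventually_filter_add)
  qed
  \<comment> \<open>\<open>T\<close> encodes the ultrafilters containing all tails. Since
    \<open>top\<close> encodes all of \<open>beta\<close>, the second filter encodes the left ideal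
    generated by translating \<open>beta\<close> by \<open>q\<close>, which lies in
    \<open>K_beta\<close>.\<close>
  let ?F = "inf T (top \<oplus>\<^sub>\<beta> q)"
  have qT: "q \<le> T" using q(2) T by blast
  then have "q \<oplus>\<^sub>\<beta> q \<le> ?F" by (simp add: T_add filter_add_mono_left)
  then have "?F \<noteq> bot"
    by (rule beta_le_neq_bot[OF filter_add_in_beta[OF qb qb]])
  moreover have "semigroup_filter ?F"
    unfolding semigroup_filter_def
  proof (intro ballI impI)
    fix r s assume r: "r \<in> beta" "r \<le> ?F" and s: "s \<in> beta" "s \<le> ?F"
    obtain u where "u \<oplus>\<^sub>\<beta> q = s" using le_filter_add_obtains[OF qb s(1)] s(2) by auto
    then have "r \<oplus>\<^sub>\<beta> s = r \<oplus>\<^sub>\<beta> u \<oplus>\<^sub>\<beta> q" by (simp add: filter_add_assoc)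
    then have "r \<oplus>\<^sub>\<beta> s \<le> top \<oplus>\<^sub>\<beta> q" by (simp add: filter_add_mono_left)
    then show "r \<oplus>\<^sub>\<beta> s \<le> ?F" using r s T_add by simp
  qed
  ultimately obtain p where p: "p \<in> beta" "p \<le> ?F" "p \<oplus>\<^sub>\<beta> p = p"
    using idempotent_exists by blast
  obtain u where "u \<in> beta" "u \<oplus>\<^sub>\<beta> q = p" using le_filter_add_obtains[OF qb p(1)] p(2) by auto
  then have "p \<in> K_beta" using filter_add_K_beta q(1) by blast
  then show thesis using that p(2,3) T by simp
qed

section \<open>Construction of the subsystem\<close>

text \<open>These are the members \<open>C\<close> of \<open>p\<close> that equal their own star set
  \<open>{x \<in> C. -x + C \<in> p}\<close> from the usual proof of Hindman's theorem.\<close>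

definition star_set :: "'a::plus filter \<Rightarrow> 'a set \<Rightarrow> bool" where
  "star_set p C \<longleftrightarrow> mem_filter C p \<and> (\<forall>x\<in>C. \<forall>\<^sub>F y in p. x + y \<in> C)"

text \<open>The star of \<open>B\<close> works: idempotence yields both that it belongs to
  \<open>p\<close> and that its translates by its own elements do.\<close>

lemma star_set_exists:
  fixes p :: "'a::semigroup_add filter"
  assumes "p \<oplus>\<^sub>\<beta> p = p" "mem_filter B p"
  shows "\<exists>C\<subseteq>B. star_set p C"
proof (intro exI[of _ "{x \<in> B. \<forall>\<^sub>F y in p. x + y \<in> B}"] conjI)
  have idem: "(\<forall>\<^sub>F x in p. P x) \<longleftrightarrow> (\<forall>\<^sub>F x in p. \<forall>\<^sub>F y in p. P (x + y))" for P
    using eventually_filter_add[of P p p] assms(1) by simp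
  have "\<forall>\<^sub>F x in p. \<forall>\<^sub>F y in p. x + y \<in> B"
    using assms(2) idem[of "\<lambda>x. x \<in> B"] by (simp add: mem_filter_def)
  moreover have "\<forall>\<^sub>F y in p. x + y \<in> B \<and> (\<forall>\<^sub>F z in p. x + y + z \<in> B)"
    if "\<forall>\<^sub>F y in p. x + y \<in> B" for x
    using that idem[of "\<lambda>y. x + y \<in> B"] by (simp add: eventually_conj_iff add.assoc)
  ultimately show "star_set p {x \<in> B. \<forall>\<^sub>F y in p. x + y \<in> B}"
    using assms(2) by (simp add: star_set_def mem_filter_def eventually_conj_iff)
qed auto

lemma star_set_Int: "star_set p C \<Longrightarrow> star_set p D \<Longrightarrow> star_set p (C \<inter> D)"
  by (simp add: star_set_def mem_filter_def eventually_conj_iff)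

lemma star_set_translate:
  fixes p :: "'a::semigroup_add filter"
  shows "star_set p C \<Longrightarrow> x \<in> C \<Longrightarrow> star_set p {z. x + z \<in> C}"
  by (simp add: star_set_def mem_filter_def add.assoc[symmetric])

text \<open>
  \<open>Q n\<close> overestimates the products of distinct terms with index below \<open>n\<close>: the term \<open>x n\<close>
  occurs at most once in a product, which is then of the form \<open>u * x n * v\<close>.
\<close>

lemma prod_list_mem_if_closed:
  fixes x :: "nat \<Rightarrow> 'a::monoid_mult"
  assumes "\<And>n. 1 \<in> Q n" "\<And>n. Q n \<subseteq> Q (Suc n)"
    and "\<And>n u v. u \<in> Q n \<Longrightarrow> v \<in> Q n \<Longrightarrow> u * x n * v \<in> Q (Suc n)"
    and "distinct is" "set is \<subseteq> {..<n}"
  shows "prod_list (map x is) \<in> Q n"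
  using assms(4,5)
proof (induction n arbitrary: "is")
  case 0
  then show ?case by (simp add: assms(1))
next
  case (Suc n)
  show ?case
  proof (cases "n \<in> set is")
    case True
    then obtain us vs where eq: "is = us @ n # vs" by (meson split_list)
    have "set us \<subseteq> {..<n}" "set vs \<subseteq> {..<n}"
      using Suc.prems eq by (auto simp: less_Suc_eq)
    then have "prod_list (map x us) \<in> Q n" "prod_list (map x vs) \<in> Q n"
      using Suc.prems eq Suc.IH by auto
    then show ?thesis using assms(3) by (simp add: eq mult.assoc[symmetric])
  next
    case False
    then have "set is \<subseteq> {..<n}" using Suc.prems(2) by (auto simp: less_Suc_eq)
    then show ?thesis using Suc.IH Suc.prems(1) assms(2) by blast
  qed
qed

text \<open>Injections become distinct lists, and the strict bound \<open>Suc k\<close> fits the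
  induction on \<open>n\<close> in the preceding lemma.\<close>

lemma AP_subset_prod_list:
  "AP x k \<subseteq> {prod_list (map x is) | is. distinct is \<and> set is \<subseteq> {..<Suc k}}"
proof
  fix b assume "b \<in> AP x k"
  then obtain r \<sigma> where b: "b = prod_list (map (\<lambda>i. x (\<sigma> i)) [1..<r+1])"
    and s: "inj_on \<sigma> {1..r}" "\<sigma> ` {1..r} \<subseteq> {1..k}" by (auto simp: AP_def)
  have "set [1..<r+1] = {1..r}" by auto
  then have "distinct (map \<sigma> [1..<r+1])" "set (map \<sigma> [1..<r+1]) \<subseteq> {..<Suc k}"
    using s by (auto simp: distinct_map simp del: upt_Suc)
  moreover have "b = prod_list (map x (map \<sigma> [1..<r+1]))" by (simp add: b comp_def)
  ultimately show "b \<in> {prod_list (map x is) | is. distinct is \<and> set is \<subseteq> {..<Suc k}}" by blast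
qed

text \<open>Split off the smallest index \<open>k\<close>: the remaining sum lies in a later, hence
  smaller, set of the decreasing family \<open>C\<close>, in particular in \<open>C (Suc k)\<close>,
  and \<open>step\<close> adds \<open>x k\<close>.\<close>

lemma sum_mem_if_closed:
  fixes x :: "nat \<Rightarrow> 'a::comm_monoid_add"
  assumes x: "\<And>n. x n \<in> C n"
    and step: "\<And>n z. z \<in> C (Suc n) \<Longrightarrow> z \<in> C n \<and> x n + z \<in> C n"
    and F: "finite F" "F \<noteq> {}" "F \<subseteq> {n..}"
  shows "sum x F \<in> C n"
proof -
  have anti: "C m \<subseteq> C n" if "n \<le> m" for n m
    using step by (intro lift_Suc_antimono_le[of C, OF _ that]) blast
  have "sum x F \<in> C (Min F)" using F(1,2)
  proof (induction "card F" arbitrary: F)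
    case 0
    then show ?case by simp
  next
    case (Suc c)
    let ?k = "Min F" and ?G = "F - {Min F}"
    have k: "?k \<in> F" using Suc.prems by simp
    have sum: "sum x F = x ?k + sum x ?G" using Suc.prems k by (simp add: sum.remove)
    show ?case
    proof (cases "?G = {}")
      case True
      show ?thesis using x unfolding sum True by simp
    next
      case False
      have "c = card ?G" using Suc.hyps(2) k by simp
      then have G: "sum x ?G \<in> C (Min ?G)" using Suc.hyps(1) Suc.prems(1) False by blast
      have "Min ?G \<in> ?G" using False Suc.prems(1) by (intro Min_in) auto
      then have "Suc ?k \<le> Min ?G"
        using Min_le[OF Suc.prems(1), of "Min ?G"] by (auto simp: Suc_le_eq order.strict_iff_order)
      then have "sum x ?G \<in> C (Suc ?k)" using G anti by blast
      then show ?thesis using step sum by simp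
    qed
  qed
  moreover have "n \<le> Min F" using F by (auto simp: subset_iff)
  ultimately show ?thesis using anti by blast
qed

theorem theorem3p4:
  fixes A :: "lipschitz set" and y :: "nat \<Rightarrow> lipschitz"
  assumes "central_star A"
    and "minimal_sequence y"
  shows "\<exists>x. sum_subsystem x y \<and>
    (\<forall>m\<ge>2. \<forall>F b. finite F \<and> F \<noteq> {} \<and> F \<subseteq> {1..} \<and> m \<le> Min F \<and> b \<in> AP x (m - 1)
       \<longrightarrow> b * (\<Sum>t\<in>F. x t) \<in> A) \<and>
    FS x 1 \<union> {b * x m | b m. 2 \<le> m \<and> b \<in> AP x (m - 1)} \<subseteq> A"
proof -
  obtain p where p: "p \<in> K_beta" "p \<oplus>\<^sub>\<beta> p = p" and FS: "\<And>m. 1 \<le> m \<Longrightarrow> mem_filter (FS y m) p"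
    using minimal_sequence_idempotent[OF assms(2)] by blast
  have pb: "p \<noteq> bot" using p(1) K_beta_subset_beta by (auto simp: beta_def)
  \<comment> \<open>\<open>0\<close> is excluded so that all products of terms \<open>x n\<close> are nonzero.\<close>
  define good where "good b = {z. z \<noteq> 0 \<and> b * z \<in> A}" for b
  have good: "\<exists>C. star_set p C \<and> (\<forall>b\<in>Q. C \<subseteq> good b)" if "finite Q" "0 \<notin> Q" for Q
  proof -
    have "\<forall>\<^sub>F z in p. \<forall>b\<in>Q. z \<in> good b"
    proof (rule eventually_ball_finite[OF that(1)], rule ballI)
      fix b assume "b \<in> Q"
      then have "b \<noteq> 0" using that(2) by blast
      then show "\<forall>\<^sub>F z in p. z \<in> good b"
        using central_star_mult[OF assms(1) p] K_beta_nonprincipal[OF infinite_UNIV_lipschitz p(1)]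
        by (simp add: good_def eventually_conj_iff)
    qed
    then have "mem_filter {z. \<forall>b\<in>Q. z \<in> good b} p" by (simp add: mem_filter_def)
    then obtain C where "C \<subseteq> {z. \<forall>b\<in>Q. z \<in> good b}" "star_set p C"
      using star_set_exists[OF p(2)] by blast
    then show ?thesis by blast
  qed
  have pick: "\<exists>H. finite H \<and> H \<noteq> {} \<and> H \<subseteq> {m..} \<and> sum y H \<in> C"
    if "star_set p C" "1 \<le> m" for C m
  proof -
    have "\<forall>\<^sub>F z in p. z \<in> C \<and> z \<in> FS y m"
      using that FS[of m] by (simp add: star_set_def mem_filter_def eventually_conj_iff)
    then obtain z where "z \<in> C" "z \<in> FS y m" using pb eventually_happens' by blast
    then show ?thesis by (auto simp: FS_def)
  qed
  \<comment> \<open>In a state, \<open>Q\<close> holds the multipliers so far, \<open>C\<close> is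
    the reservoir for the current term and all later sums, and \<open>H\<close> is the index block
    of the current term.\<close>
  define inv where "inv = (\<lambda>(Q, C, H).
    finite Q \<and> 0 \<notin> Q \<and> 1 \<in> Q \<and> star_set p C \<and> (\<forall>b\<in>Q. C \<subseteq> good b) \<and>
    finite H \<and> H \<noteq> {} \<and> H \<subseteq> {1..} \<and> sum y H \<in> C)"
  define step where "step = (\<lambda>(Q, C, H) (Q', C', H').
    Q \<subseteq> Q' \<and> (\<forall>u\<in>Q. \<forall>v\<in>Q. u * sum y H * v \<in> Q') \<and>
    (\<forall>z\<in>C'. z \<in> C \<and> sum y H + z \<in> C) \<and> Max H < (Min H' :: nat))"
  have "\<exists>f. \<forall>n. inv (f n) \<and> step (f n) (f (Suc n))"
  proof (rule dependent_nat_choice[of "\<lambda>_. inv" "\<lambda>_. step"])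
    obtain C where C: "star_set p C" "\<forall>b\<in>{1}. C \<subseteq> good b" using good[of "{1}"] by auto
    obtain H where "finite H" "H \<noteq> {}" "H \<subseteq> {1..}" "sum y H \<in> C" using pick[OF C(1), of 1] by auto
    then have "inv ({1}, C, H)" using C by (simp add: inv_def)
    then show "\<exists>s. inv s" by blast
  next
    fix s n assume "inv s"
    then obtain Q C H where s: "s = (Q, C, H)" and Q: "finite Q" "0 \<notin> Q" "1 \<in> Q"
      and C: "star_set p C" "\<forall>b\<in>Q. C \<subseteq> good b"
      and H: "finite H" "H \<noteq> {}" "H \<subseteq> {1..}" "sum y H \<in> C"
      by (cases s) (auto simp: inv_def)
    let ?x = "sum y H"
    \<comment> \<open>Nonzero because \<open>1 \<in> Q\<close> gives
      \<open>C \<subseteq> good 1\<close>; without zero divisors, \<open>0\<close> then stays out of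
      \<open>?Q\<close>.\<close>
    have x0: "?x \<noteq> 0" using C(2) H(4) Q(3) by (auto simp: good_def)
    let ?Q = "Q \<union> (\<lambda>(u, v). u * ?x * v) ` (Q \<times> Q)"
    have Q': "finite ?Q" "0 \<notin> ?Q" "1 \<in> ?Q"
      using Q x0 by (auto dest!: sym[of 0] dest!: lipschitz_mult_eq_0)
    obtain D where D: "star_set p D" "\<forall>b\<in>?Q. D \<subseteq> good b" using good[OF Q'(1,2)] by blast
    \<comment> \<open>The three factors make the reservoirs decrease, allow \<open>?x\<close> to be
      added to later sums, and handle the new multipliers in \<open>?Q\<close>.\<close>
    let ?C = "C \<inter> {z. ?x + z \<in> C} \<inter> D"
    have C': "star_set p ?C"
      using C(1) D(1) H(4) by (intro star_set_Int star_set_translate)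
    obtain H' where H': "finite H'" "H' \<noteq> {}" "H' \<subseteq> {Suc (Max H)..}" "sum y H' \<in> ?C"
      using pick[OF C', of "Suc (Max H)"] by auto
    have "Max H < Min H'" using H' Min_in[of H'] by (auto simp: Suc_le_eq subset_iff)
    moreover have "H' \<subseteq> {1..}" using H'(3) by auto
    moreover have "\<forall>b\<in>?Q. ?C \<subseteq> good b" using D(2) by blast
    ultimately have "inv (?Q, ?C, H') \<and> step s (?Q, ?C, H')"
      using Q' C' H' unfolding inv_def step_def s by auto
    then show "\<exists>s'. inv s' \<and> step s s'" by blast
  qed
  then obtain f where f: "\<And>n. inv (f n)" "\<And>n. step (f n) (f (Suc n))" by blast
  define Q C H where "Q n = fst (f n)" and "C n = fst (snd (f n))" and "H n = snd (snd (f n))" for n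
  define x where "x n = sum y (H n)" for n
  have fn: "f n = (Q n, C n, H n)" for n by (simp add: Q_def C_def H_def)
  have Q: "1 \<in> Q n" "\<forall>b\<in>Q n. C n \<subseteq> good b" and xC: "x n \<in> C n"
    and H: "finite (H n)" "H n \<noteq> {}" "H n \<subseteq> {1..}" for n
    using f(1)[of n] by (auto simp: inv_def fn x_def)
  have st: "Q n \<subseteq> Q (Suc n)" "u \<in> Q n \<Longrightarrow> v \<in> Q n \<Longrightarrow> u * x n * v \<in> Q (Suc n)"
    "z \<in> C (Suc n) \<Longrightarrow> z \<in> C n \<and> x n + z \<in> C n" "Max (H n) < Min (H (Suc n))" for n u v z
    using f(2)[of n] by (auto simp: step_def fn x_def)
  have mem: "b * sum x F \<in> A" if "b \<in> Q n" "finite F" "F \<noteq> {}" "F \<subseteq> {n..}" for b n F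
    using sum_mem_if_closed[of x C F n, OF xC st(3) that(2-4)] Q(2) that(1) by (auto simp: good_def)
  \<comment> \<open>\<open>Q m\<close> contains the products over indices below \<open>m\<close>,
    index \<open>0\<close> included since \<open>f\<close> starts there; the indices in
    \<open>AP x (m - 1)\<close> are at most \<open>m - 1\<close>.\<close>
  have AP: "b \<in> Q m" if "2 \<le> m" "b \<in> AP x (m - 1)" for m b
    using AP_subset_prod_list[of x "m - 1"] that
      prod_list_mem_if_closed[of Q x _ m, OF Q(1) st(1,2)] by auto
  have main: "b * sum x F \<in> A"
    if "2 \<le> m" "finite F" "F \<noteq> {}" "m \<le> Min F" "b \<in> AP x (m - 1)" for m F b
    using mem[OF AP[OF that(1,5)]] that by (auto simp: subset_iff)
  show ?thesis
  proof (intro exI[of _ x] conjI)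
    show "sum_subsystem x y"
      unfolding sum_subsystem_def using H st(4) by (intro exI[of _ H]) (simp add: x_def)
    show "\<forall>m\<ge>2. \<forall>F b. finite F \<and> F \<noteq> {} \<and> F \<subseteq> {1..} \<and> m \<le> Min F \<and> b \<in> AP x (m - 1)
       \<longrightarrow> b * (\<Sum>t\<in>F. x t) \<in> A"
      using main by blast
    \<comment> \<open>The multiplier \<open>1 \<in> Q 1\<close> also reaches sums that use the index
      1, which \<open>main\<close> excludes by \<open>2 \<le> m\<close>.\<close>
    have "FS x 1 \<subseteq> A" using mem[OF Q(1)] by (auto simp: FS_def)
    moreover have "b * x m \<in> A" if "2 \<le> m" "b \<in> AP x (m - 1)" for b m
      using main[OF that(1) _ _ _ that(2), of "{m}"] by simp
    ultimately show "FS x 1 \<union> {b * x m | b m. 2 \<le> m \<and> b \<in> AP x (m - 1)} \<subseteq> A" by blast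
  qed
qed

end
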